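(* Let $q\ge 19$ be an odd prime and let $H$ be an integer with $\lfloor (q-1)/3\rfloor\le H\le (q-1)/2$. Let $\mathcal{V}_H=\{(1,i,i^2): i=0,1,\dots,H\}$, $P=(0,1,0)$, $T_H=(0,1,b_H)$ where $b_H=2H+1$ if $H=\lfloor (q-1)/3\rfloor$ and $b_H=2H$ if $\lfloor (q-1)/3\rfloor<H\le (q-1)/2$. Then $\mathcal{K}_H=\mathcal{V}_H\cup\{P,T_H\}$ is an $(H+3)$-arc in $PG(2,q)$.
   Context: Points of $PG(2,q)$ are in homogeneous coordinates $(x_0,x_1,x_2)$; integers are read modulo $q$ as elements of $F_q$. An arc is a set of points no three of which are collinear. *)

theory Defs
  imports "HOL-Analysis.Cartesian_Space" "HOL-Computational_Algebra.Primes"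
begin

text \<open>The projective plane over the field \<open>'a\<close>: points and lines are the one- and
  two-dimensional linear subspaces of \<open>'a ^ 3\<close>, and incidence is inclusion.\<close>

definition pg_points :: "('a::field ^ 3) set set" where
  "pg_points = {U. vec.subspace U \<and> vec.dim U = 1}"

definition pg_lines :: "('a::field ^ 3) set set" where
  "pg_lines = {L. vec.subspace L \<and> vec.dim L = 2}"

definition pg_collinear :: "('a::field ^ 3) set set \<Rightarrow> bool" where
  "pg_collinear S \<longleftrightarrow> (\<exists>L\<in>pg_lines. \<forall>U\<in>S. U \<subseteq> L)"

definition pg_arc :: "('a::field ^ 3) set set \<Rightarrow> bool" where
  "pg_arc K \<longleftrightarrow> K \<subseteq> pg_points \<and>
     (\<forall>A\<in>K. \<forall>B\<in>K. \<forall>C\<in>K. A \<noteq> B \<and> A \<noteq> C \<and> B \<noteq> C \<longrightarrow> \<not> pg_collinear {A, B, C})"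

definition pg_k_arc :: "nat \<Rightarrow> ('a::field ^ 3) set set \<Rightarrow> bool" where
  "pg_k_arc k K \<longleftrightarrow> pg_arc K \<and> finite K \<and> card K = k"

text \<open>The point with homogeneous coordinates \<open>(x0, x1, x2)\<close>; it lies in \<open>pg_points\<close> only
  if the coordinates are not all zero.\<close>

definition hpoint :: "'a::field \<Rightarrow> 'a \<Rightarrow> 'a \<Rightarrow> ('a ^ 3) set" where
  "hpoint x0 x1 x2 = vec.span {vector [x0, x1, x2]}"

definition V_set :: "nat \<Rightarrow> ('a::field ^ 3) set set" where
  "V_set H = {hpoint 1 (of_nat i) ((of_nat i)\<^sup>2) | i. i \<in> {0..H}}"

definition P_point :: "('a::field ^ 3) set" where
  "P_point = hpoint 0 1 0"

definition b_coord :: "nat \<Rightarrow> nat \<Rightarrow> nat" where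
  "b_coord q H = (if H = (q - 1) div 3 then 2 * H + 1 else 2 * H)"

definition T_point :: "nat \<Rightarrow> nat \<Rightarrow> ('a::field ^ 3) set" where
  "T_point q H = hpoint 0 1 (of_nat (b_coord q H))"

definition K_set :: "nat \<Rightarrow> nat \<Rightarrow> ('a::field ^ 3) set set" where
  "K_set q H = V_set H \<union> {P_point, T_point q H}"

end

theory Submission
  imports Defs "HOL-Analysis.Determinants" "HOL-Number_Theory.Residues"
begin

text \<open>The determinants of triples of points of the arc factor into terms \<open>i - j\<close>, \<open>i + j\<close>,
  \<open>b - (i + j)\<close> and \<open>b\<close> with \<open>0 \<le> i, j \<le> H\<close> and \<open>i \<noteq> j\<close>, where \<open>b\<close> is the last
  coordinate of \<open>T\<close>. Then \<open>0 < i + j < 2 H \<le> b < q\<close>, so these integers are nonzero and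
  smaller than \<open>q\<close> in absolute value, hence nonzero in the field.\<close>

text \<open>The characteristic divides the prime order \<open>q\<close> and is not 1, so it equals
  \<open>q\<close>, and naturals below \<open>q\<close> are distinct residues.\<close>

lemma of_nat_eq_iff_less_prime_CARD:
  assumes "prime q" "CARD('a::field) = q" "m < q" "n < q"
  shows "(of_nat m :: 'a) = of_nat n \<longleftrightarrow> m = n"
proof -
  have "CHAR('a) dvd q"
    using CHAR_dvd_CARD[where 'a = 'a] assms by simp
  moreover have "CHAR('a) \<noteq> 1"
    by simp
  ultimately have "CHAR('a) = q"
    using assms(1) by (auto simp: prime_nat_iff)
  then show ?thesis
    using assms(3,4) by (simp add: of_nat_eq_iff_cong_CHAR cong_def)
qed

lemma rows_vector_3: "rows (vector [u, v, w] :: 'a::zero ^ 'n ^ 3) = {u, v, w}"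
proof -
  have "row i (vector [u, v, w] :: 'a ^ 'n ^ 3) = (vector [u, v, w] :: 'a ^ 'n ^ 3) $ i" for i
    by (simp add: row_def)
  then show ?thesis
    by (simp add: rows_def full_SetCompr_eq) (simp add: UNIV_3)
qed

text \<open>Rows with nonzero determinant are linearly independent, and a subspace of dimension 2
  has no room for three such vectors.\<close>

lemma det_eq_0_in_line:
  fixes u v w :: "'a::field ^ 3"
  assumes "L \<in> pg_lines" "u \<in> L" "v \<in> L" "w \<in> L"
  shows "det (vector [u, v, w] :: 'a ^ 3 ^ 3) = 0"
proof (rule ccontr)
  assume nz: "det (vector [u, v, w] :: 'a ^ 3 ^ 3) \<noteq> 0"
  then have "vec.independent {u, v, w}"
    using det_dependent_rows rows_vector_3 by metis
  moreover have "{u, v, w} \<subseteq> L" "vec.dim L = 2"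
    using assms by (auto simp: pg_lines_def)
  ultimately have "card {u, v, w} \<le> 2"
    using vec.independent_card_le_dim by metis
  \<comment> \<open>A repeated row would make the determinant vanish; distinctness is what turns the
    set \<open>{u, v, w}\<close> into one of cardinality 3.\<close>
  moreover have "u \<noteq> v" "u \<noteq> w" "v \<noteq> w"
    using nz by (auto simp: det_3)
  ultimately show False by simp
qed

text \<open>The left-hand side is the determinant of the coordinate vectors, expanded along the
  first row. Each non-collinearity proof below factors it.\<close>

lemma pg_collinear_hpointD:
  fixes a b c :: "'a::field"
  assumes "pg_collinear {hpoint a b c, hpoint d e f, hpoint g h k}"
  shows "a * (e * k - f * h) - b * (d * k - f * g) + c * (d * h - e * g) = 0"
proof -
  obtain L where L: "L \<in> pg_lines" "hpoint a b c \<subseteq> L" "hpoint d e f \<subseteq> L" "hpoint g h k \<subseteq> L"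
    using assms by (auto simp: pg_collinear_def)
  have "vector [x, y, z] \<in> hpoint x y z" for x y z :: 'a
    by (simp add: hpoint_def vec.span_base)
  then have "det (vector [vector [a, b, c], vector [d, e, f], vector [g, h, k]] :: 'a ^ 3 ^ 3) = 0"
    using L by (intro det_eq_0_in_line[of L]) auto
  then show ?thesis
    by (simp add: det_3 algebra_simps)
qed

lemma hpoint_in_pg_points:
  assumes "a \<noteq> 0 \<or> b \<noteq> 0 \<or> c \<noteq> 0"
  shows "hpoint a b c \<in> pg_points"
proof -
  have "(vector [a, b, c] :: 'a ^ 3) \<noteq> 0"
    using assms by (auto simp: vec_eq_iff forall_3)
  then show ?thesis
    by (simp add: hpoint_def pg_points_def vec.dim_span)
qed

lemma hpoint_eqD:
  fixes a b c :: "'a::field"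
  assumes "hpoint a b c = hpoint d e f"
  shows "\<exists>k. a = k * d \<and> b = k * e \<and> c = k * f"
proof -
  have "vector [a, b, c] \<in> hpoint d e f"
    using assms vec.span_base by (metis hpoint_def singletonI)
  then obtain k where "vector [a, b, c] = k *s (vector [d, e, f] :: 'a ^ 3)"
    by (auto simp: hpoint_def vec.span_singleton)
  then show ?thesis
    by (intro exI[of _ k]) (simp add: vec_eq_iff forall_3)
qed

text \<open>The determinant is the Vandermonde product of the differences.\<close>

lemma not_collinear_conic:
  fixes x y z :: "'a::field"
  assumes "x \<noteq> y" "x \<noteq> z" "y \<noteq> z"
  shows "\<not> pg_collinear {hpoint 1 x (x\<^sup>2), hpoint 1 y (y\<^sup>2), hpoint 1 z (z\<^sup>2)}"
proof
  assume "pg_collinear {hpoint 1 x (x\<^sup>2), hpoint 1 y (y\<^sup>2), hpoint 1 z (z\<^sup>2)}"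
  from pg_collinear_hpointD[OF this] have "(y - x) * (z - x) * (z - y) = 0"
    by (simp add: algebra_simps power2_eq_square)
  then show False
    using assms by auto
qed

text \<open>The chord through the conic points with parameters \<open>x\<close> and \<open>y\<close>
  has slope \<open>x + y\<close>, so it meets the line x0 = 0 exactly in (0, 1, x + y).\<close>

lemma not_collinear_conic_infinity:
  fixes x y t :: "'a::field"
  assumes "x \<noteq> y" "x + y \<noteq> t"
  shows "\<not> pg_collinear {hpoint 1 x (x\<^sup>2), hpoint 1 y (y\<^sup>2), hpoint 0 1 t}"
proof
  assume "pg_collinear {hpoint 1 x (x\<^sup>2), hpoint 1 y (y\<^sup>2), hpoint 0 1 t}"
  from pg_collinear_hpointD[OF this] have "(y - x) * (t - (x + y)) = 0"
    by (simp add: algebra_simps power2_eq_square)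
  then show False
    using assms by auto
qed

text \<open>The determinant reduces to \<open>t - s\<close>: two distinct points of x0 = 0 span that
  line, which contains no point with x0 = 1.\<close>

lemma not_collinear_affine_infinity:
  fixes s t :: "'a::field"
  assumes "s \<noteq> t"
  shows "\<not> pg_collinear {hpoint 1 x y, hpoint 0 1 s, hpoint 0 1 t}"
  using pg_collinear_hpointD[of 1 x y 0 1 s 0 1 t] assms by auto

text \<open>The leading coordinate 1 on both sides forces the proportionality factor to be
  1.\<close>

lemma hpoint_affine_eq_iff:
  fixes x y x' y' :: "'a::field"
  shows "hpoint 1 x y = hpoint 1 x' y' \<longleftrightarrow> x = x' \<and> y = y'"
  by (auto dest!: hpoint_eqD)

lemma hpoint_infinity_eq_iff:
  fixes s t :: "'a::field"
  shows "hpoint 0 1 s = hpoint 0 1 t \<longleftrightarrow> s = t"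
  by (auto dest!: hpoint_eqD)

lemma hpoint_affine_neq_infinity:
  fixes x y s t :: "'a::field"
  shows "hpoint 1 x y \<noteq> hpoint 0 s t"
  by (auto dest!: hpoint_eqD)

theorem theorem9:
  fixes q H :: nat
  assumes "prime q" and "odd q" and "q \<ge> 19"
    and "CARD('a::field) = q"
    and "(q - 1) div 3 \<le> H" and "H \<le> (q - 1) div 2"
  shows "pg_k_arc (H + 3) (K_set q H :: ('a ^ 3) set set)"
proof -
  define b where "b = b_coord q H"
  define V :: "nat \<Rightarrow> ('a ^ 3) set" where "V i = hpoint 1 (of_nat i) ((of_nat i)\<^sup>2)" for i
  define P :: "('a ^ 3) set" where "P = hpoint 0 1 0"
  define T :: "('a ^ 3) set" where "T = hpoint 0 1 (of_nat b)"
  have K: "K_set q H = V ` {..H} \<union> {P, T}"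
    by (auto simp: K_set_def V_set_def P_point_def T_point_def V_def P_def T_def b_def)
  \<comment> \<open>For the smallest \<open>H\<close>, \<open>b\<close> = 2H + 1 is at most 2(q -
    1)/3 + 1 < q; otherwise \<open>b\<close> = 2H is at most q - 1.\<close>
  have b: "2 * H \<le> b" "b < q" "0 < b" and H: "2 * H < q"
    using assms(3,5,6) by (auto simp: b_def b_coord_def)
  note inj = of_nat_eq_iff_less_prime_CARD[OF assms(1,4)]
  have neq: "(of_nat i :: 'a) \<noteq> of_nat j" if "i \<noteq> j" "i \<le> H" "j \<le> H" for i j
    using that H inj[of i j] by simp
  have b0: "(of_nat b :: 'a) \<noteq> 0"
    using inj[of b 0] b by simp
  have sum: "(of_nat i + of_nat j :: 'a) \<noteq> 0" "(of_nat i + of_nat j :: 'a) \<noteq> of_nat b"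
    if "i \<noteq> j" "i \<le> H" "j \<le> H" for i j
  proof -
    \<comment> \<open>Since \<open>i\<close> and \<open>j\<close> are distinct and at most
      \<open>H\<close>, their sum lies between 1 and 2H - 1; so even \<open>b\<close> = 2H is never
      attained.\<close>
    have "0 < i + j" "i + j < b"
      using that b by linarith+
    then show "(of_nat i + of_nat j :: 'a) \<noteq> 0" "(of_nat i + of_nat j :: 'a) \<noteq> of_nat b"
      using b inj[of "i + j" 0] inj[of "i + j" b] by simp_all
  qed
  have VVV: "\<not> pg_collinear {V i, V j, V k}"
    if "i \<noteq> j" "i \<noteq> k" "j \<noteq> k" "i \<le> H" "j \<le> H" "k \<le> H" for i j k
    unfolding V_def using that by (intro not_collinear_conic neq)
  \<comment> \<open>\<open>P\<close> and \<open>T\<close> are the points at infinity of slope 0 and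
    \<open>b\<close>, the two values that \<open>sum\<close> excludes for a chord slope.\<close>
  have VVP: "\<not> pg_collinear {V i, V j, P}" if "i \<noteq> j" "i \<le> H" "j \<le> H" for i j
    unfolding V_def P_def using that by (intro not_collinear_conic_infinity neq sum)
  have VVT: "\<not> pg_collinear {V i, V j, T}" if "i \<noteq> j" "i \<le> H" "j \<le> H" for i j
    unfolding V_def T_def using that by (intro not_collinear_conic_infinity neq sum)
  have VPT: "\<not> pg_collinear {V i, P, T}" for i
    unfolding V_def P_def T_def using b0 by (intro not_collinear_affine_infinity) simp
  have "pg_arc (V ` {..H} \<union> {P, T})"
    unfolding pg_arc_def
  proof (intro conjI ballI impI)
    show "V ` {..H} \<union> {P, T} \<subseteq> pg_points"
      by (auto simp: V_def P_def T_def intro: hpoint_in_pg_points)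
  next
    fix A B C
    assume mem: "A \<in> V ` {..H} \<union> {P, T}" "B \<in> V ` {..H} \<union> {P, T}" "C \<in> V ` {..H} \<union> {P, T}"
      and ne: "A \<noteq> B \<and> A \<noteq> C \<and> B \<noteq> C"
    \<comment> \<open>Collinearity depends only on the set of points, so a triple may be reordered
      to put its conic points first.\<close>
    have perms: "{A, C, B} = {A, B, C}" "{B, A, C} = {A, B, C}" "{B, C, A} = {A, B, C}"
      "{C, A, B} = {A, B, C}" "{C, B, A} = {A, B, C}"
      by blast+
    have VV: "\<not> pg_collinear {X, Y, Z}"
      if XYZ: "X \<in> V ` {..H}" "Y \<in> V ` {..H}" "Z \<in> V ` {..H} \<union> {P, T}" "X \<noteq> Y" "X \<noteq> Z" "Y \<noteq> Z"
      for X Y Z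
    proof -
      obtain i j where ij: "X = V i" "Y = V j" "i \<le> H" "j \<le> H" "i \<noteq> j"
        using XYZ(1,2,4) by (metis imageE atMost_iff)
      consider k where "Z = V k" "k \<le> H" | "Z = P" | "Z = T"
        using XYZ(3) by auto
      then show ?thesis
      proof cases
        case (1 k)
        with ij XYZ show ?thesis
          using VVV[of i j k] by metis
      qed (simp_all add: ij VVP VVT)
    qed
    have V: "\<not> pg_collinear {X, Y, Z}"
      if XYZ: "X \<in> V ` {..H}" "Y \<in> {P, T}" "Z \<in> {P, T}" "Y \<noteq> Z" for X Y Z
    proof -
      obtain i where "X = V i"
        using XYZ(1) by auto
      moreover have "{Y, Z} = {P, T}"
        using XYZ by auto
      ultimately show ?thesis
        using VPT[of i] by simp
    qed
    have "\<not> (A \<in> {P, T} \<and> B \<in> {P, T} \<and> C \<in> {P, T})"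
      using ne by (metis insertE emptyE)
    \<comment> \<open>Three distinct points cannot all lie in \<open>{P, T}\<close>. If two or more
      are on the conic, \<open>VV\<close> applies with the remaining point last; if exactly one is,
      \<open>V\<close> applies with that point first.\<close>
    then show "\<not> pg_collinear {A, B, C}"
      using mem ne VV[of A B C] VV[of A C B] VV[of B C A] V[of A B C] V[of B A C] V[of C A B]
      unfolding perms Un_iff by argo
  qed
  moreover have "card (V ` {..H} \<union> {P, T}) = H + 3"
  proof -
    have "inj_on V {..H}"
      using neq by (auto simp: inj_on_def V_def hpoint_affine_eq_iff)
    then have "card (V ` {..H}) = H + 1"
      by (simp add: card_image)
    moreover have "P \<noteq> T"
      using b0 by (simp add: P_def T_def hpoint_infinity_eq_iff)
    moreover have "V ` {..H} \<inter> {P, T} = {}"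
      by (auto simp: V_def P_def T_def hpoint_affine_neq_infinity hpoint_affine_neq_infinity[symmetric])
    ultimately show ?thesis
      by (simp add: card_Un_disjoint)
  qed
  ultimately show ?thesis
    by (simp add: pg_k_arc_def K)
qed

end
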